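(* For every non-negative integer $n$, $$\sum_{k=0}^n(-1)^{n-k}\binom nk\binom{2k}k=\sum_{k=0}^{\lfloor n/2\rfloor}\binom nk\binom{n-k}k,$$ $$\sum_{k=0}^n(-1)^{n-k}\binom nk\frac{2^{2k}}{k+1}=\sum_{k=0}^{\lfloor n/2\rfloor}\binom n{2k}\frac{2^{2k}}{2k+1},$$ and $$\sum_{k=0}^n(-1)^{n-k}\binom nk\frac{2(2k+1)}{k+2}C_k=\sum_{k=0}^{\lfloor n/2\rfloor}\binom n{2k}C_k.$$
   Context: $C_j=\frac1{j+1}\binom{2j}j$ denotes the $j$-th Catalan number, for $j$ a non-negative integer. *)

theory Defs
  imports Complex_Main
begin

definition catalan :: "nat \<Rightarrow> real" where
  "catalan j = 1 / (real j + 1) * real ((2 * j) choose j)"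

end

theory Submission
  imports Defs "HOL-Computational_Algebra.Polynomial"
begin

text \<open>
  Each left-hand side has the form \<open>\<Sum>k. (-1)^(n-k) (n choose k) L ((t+2)^k) = L ((t+1)^n)\<close> for a
  linear functional \<open>L\<close> on polynomials that vanishes on odd powers of \<open>t\<close>; expanding \<open>L ((t+1)^n)\<close>
  gives the right-hand side. The even moments \<open>L (t^(2j))\<close> are \<open>(2j choose j)\<close>, \<open>4^j/(2j+1)\<close> and
  the Catalan number \<open>C\<^sub>j\<close>. With \<open>t = x + 1/x\<close> we have \<open>t + 2 = (1+x)^2/x\<close>, and the first and third functional
  extract the coefficient of \<open>x^0\<close>, respectively its difference with that of \<open>x^2\<close>; the second
  one is the average over \<open>t \<in> [-2, 2]\<close>.
\<close>

text \<open>Binomial transforms compose by adding their shifts: if \<open>b j\<close> is L(t^j), the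
  inner sum is L((t+d)^k) and the outer one yields L((t+c+d)^n). Once the sums are exchanged,
  trinomial revision pulls \<open>n choose j\<close> out and the binomial theorem evaluates what
  remains.\<close>

lemma binomial_transform_add:
  fixes b :: "nat \<Rightarrow> 'a::comm_semiring_1"
  shows "(\<Sum>k\<le>n. c ^ (n - k) * of_nat (n choose k) *
            (\<Sum>j\<le>k. of_nat (k choose j) * d ^ (k - j) * b j))
       = (\<Sum>j\<le>n. of_nat (n choose j) * (c + d) ^ (n - j) * b j)"
proof -
  have inner: "(\<Sum>k=j..n. c ^ (n - k) * of_nat (n choose k) * (of_nat (k choose j) * d ^ (k - j) * b j))
      = of_nat (n choose j) * (c + d) ^ (n - j) * b j" if "j \<le> n" for j
  proof -
    have "(\<Sum>k=j..n. c ^ (n - k) * of_nat (n choose k) * (of_nat (k choose j) * d ^ (k - j) * b j))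
        = (\<Sum>k=j..n. of_nat (n choose j) * b j *
             (of_nat ((n - j) choose (k - j)) * d ^ (k - j) * c ^ (n - j - (k - j))))"
    proof (rule sum.cong[OF refl])
      fix k assume k: "k \<in> {j..n}"
      have eq: "(of_nat (n choose k) :: 'a) * of_nat (k choose j)
          = of_nat (n choose j) * of_nat ((n - j) choose (k - j))"
        using k choose_mult[of j k n] by (simp flip: of_nat_mult)
      have exponent: "n - j - (k - j) = n - k"
        using k by auto
      have "c ^ (n - k) * of_nat (n choose k) * (of_nat (k choose j) * d ^ (k - j) * b j)
          = (of_nat (n choose k) * of_nat (k choose j)) * (c ^ (n - k) * d ^ (k - j) * b j)"
        by (simp only: ac_simps)
      also have "\<dots> = of_nat (n choose j) * b j *
             (of_nat ((n - j) choose (k - j)) * d ^ (k - j) * c ^ (n - j - (k - j)))"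
        unfolding eq exponent by (simp only: ac_simps)
      finally show "c ^ (n - k) * of_nat (n choose k) * (of_nat (k choose j) * d ^ (k - j) * b j)
          = of_nat (n choose j) * b j *
             (of_nat ((n - j) choose (k - j)) * d ^ (k - j) * c ^ (n - j - (k - j)))" .
    qed
    also have "\<dots> = of_nat (n choose j) * b j *
        (\<Sum>i\<le>n - j. of_nat ((n - j) choose i) * d ^ i * c ^ (n - j - i))"
      unfolding sum_distrib_left
      by (rule sum.reindex_bij_witness[of _ "\<lambda>i. i + j" "\<lambda>k. k - j"]) (use that in auto)
    also have "\<dots> = of_nat (n choose j) * b j * (d + c) ^ (n - j)"
      by (simp only: binomial_ring)
    finally show ?thesis
      by (simp only: ac_simps)
  qed
  have "(\<Sum>k\<le>n. c ^ (n - k) * of_nat (n choose k) *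
            (\<Sum>j\<le>k. of_nat (k choose j) * d ^ (k - j) * b j))
      = (\<Sum>j\<le>n. \<Sum>k=j..n. c ^ (n - k) * of_nat (n choose k) * (of_nat (k choose j) * d ^ (k - j) * b j))"
    unfolding sum_distrib_left sum.Sigma[OF finite_atMost ballI[OF finite_atMost]]
      sum.Sigma[OF finite_atMost ballI[OF finite_atLeastAtMost]]
    by (rule sum.reindex_bij_witness[of _ "\<lambda>(j, k). (k, j)" "\<lambda>(k, j). (j, k)"]) auto
  also have "\<dots> = (\<Sum>j\<le>n. of_nat (n choose j) * (c + d) ^ (n - j) * b j)"
    by (intro sum.cong refl inner) auto
  finally show ?thesis .
qed

lemma sum_even_indices:
  fixes f :: "nat \<Rightarrow> 'a::comm_monoid_add"
  shows "(\<Sum>j\<le>n. if even j then f j else 0) = (\<Sum>k\<le>n div 2. f (2 * k))"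
proof -
  have "(\<Sum>j\<le>n. if even j then f j else 0) = (\<Sum>j\<in>{j. j \<le> n \<and> even j}. f j)"
    by (simp add: sum.inter_filter[symmetric])
  also have "\<dots> = (\<Sum>k\<le>n div 2. f (2 * k))"
    by (rule sum.reindex_bij_witness[of _ "\<lambda>k. 2 * k" "\<lambda>j. j div 2"]) auto
  finally show ?thesis .
qed

text \<open>The case c = -1, d = 2. Here \<open>g j\<close> is the even moment L(t^(2j)), and the
  assumption expresses \<open>a k\<close> as L((t+2)^k).\<close>

lemma binomial_transform_even:
  fixes a g :: "nat \<Rightarrow> 'a::comm_ring_1"
  assumes "\<And>k. a k = (\<Sum>j\<le>k div 2. of_nat (k choose (2 * j)) * 2 ^ (k - 2 * j) * g j)"
  shows "(\<Sum>k=0..n. (-1) ^ (n - k) * of_nat (n choose k) * a k)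
       = (\<Sum>k=0..n div 2. of_nat (n choose (2 * k)) * g k)"
proof -
  \<comment> \<open>The full moment sequence L(t^j), with zeros at the odd positions.\<close>
  define b where "b j = (if even j then g (j div 2) else 0)" for j
  have a: "a k = (\<Sum>j\<le>k. of_nat (k choose j) * 2 ^ (k - j) * b j)" for k
    using sum_even_indices[of "\<lambda>j. of_nat (k choose j) * 2 ^ (k - j) * g (j div 2)" k]
    by (simp add: assms b_def if_distrib cong: if_cong)
  have "(\<Sum>k\<le>n. (-1) ^ (n - k) * of_nat (n choose k) * a k) = (\<Sum>j\<le>n. of_nat (n choose j) * b j)"
    unfolding a binomial_transform_add by simp
  also have "\<dots> = (\<Sum>k\<le>n div 2. of_nat (n choose (2 * k)) * g k)"
    using sum_even_indices[of "\<lambda>j. of_nat (n choose j) * g (j div 2)" n]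
    by (simp add: b_def if_distrib cong: if_cong)
  finally show ?thesis
    by (simp add: atLeast0AtMost)
qed

lemma coeff_one_plus_square_power:
  "coeff ((1 + monom (1::'a::comm_semiring_1) 2) ^ j) m
     = (if even m then of_nat (j choose (m div 2)) else 0)"
proof -
  have "(1 + monom (1::'a) 2) ^ j = (\<Sum>i\<le>j. of_nat (j choose i) * monom 1 (2 * i))"
    using binomial_ring[of "monom (1::'a) 2" 1 j] by (simp add: monom_power add.commute)
  also have "coeff \<dots> m = (\<Sum>i\<le>j. if 2 * i = m then of_nat (j choose i) else 0)"
    by (simp add: coeff_sum of_nat_poly smult_monom)
  also have "\<dots> = (if even m then of_nat (j choose (m div 2)) else 0)"
  proof (cases "even m")
    case True
    then have "2 * i = m \<longleftrightarrow> i = m div 2" for i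
      by auto
    \<comment> \<open>If \<open>m div 2\<close> exceeds \<open>j\<close>, no index matches, in
      agreement with the binomial coefficient being 0.\<close>
    with True show ?thesis
      by (simp add: binomial_eq_0)
  next
    case False
    then show ?thesis
      by (auto intro!: sum.neutral)
  qed
  finally show ?thesis .
qed

text \<open>Compare coefficients of \<open>x^(k+2r)\<close> in \<open>(1+x)^(2k) = ((1+x^2) + 2x)^k\<close>.\<close>

lemma central_binomial_expansion:
  "real ((2 * k) choose (k + 2 * r))
     = (\<Sum>j\<le>k div 2. real (k choose (2 * j)) * 2 ^ (k - 2 * j) * real ((2 * j) choose (j + r)))"
proof -
  let ?p = "1 + monom (1::real) 2"
  have "[:1, 1::real:] ^ (2 * k) = (?p + monom 2 1) ^ k"
    unfolding power_mult by (simp add: power2_eq_square monom_altdef one_pCons numeral_2_eq_2)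
  also have "\<dots> = (\<Sum>j\<le>k. of_nat (k choose j) * ?p ^ j * monom (2 ^ (k - j)) (k - j))"
    by (simp add: binomial_ring monom_power)
  finally have "coeff ([:1, 1::real:] ^ (2 * k)) (k + 2 * r)
      = (\<Sum>j\<le>k. coeff (of_nat (k choose j) * ?p ^ j * monom (2 ^ (k - j)) (k - j)) (k + 2 * r))"
    by (simp add: coeff_sum)
  also have "\<dots> = (\<Sum>j\<le>k. if even j
      then real (k choose j) * 2 ^ (k - j) * real (j choose (j div 2 + r)) else 0)"
  proof (rule sum.cong[OF refl])
    fix j assume "j \<in> {..k}"
    \<comment> \<open>The factor x^(k-j) lowers the exponent sought in (1+x^2)^j to j+2r, which has
      the parity of j; hence odd j contribute nothing.\<close>
    then have "j \<le> k" and *: "k + 2 * r - (k - j) = j + 2 * r"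
      by auto
    then have "coeff (of_nat (k choose j) * ?p ^ j * monom (2 ^ (k - j)) (k - j)) (k + 2 * r)
        = 2 ^ (k - j) * (real (k choose j) * coeff (?p ^ j) (j + 2 * r))"
      by (simp add: mult.commute[of _ "monom _ _"] coeff_monom_mult of_nat_poly *)
    then show "coeff (of_nat (k choose j) * ?p ^ j * monom (2 ^ (k - j)) (k - j)) (k + 2 * r)
        = (if even j then real (k choose j) * 2 ^ (k - j) * real (j choose (j div 2 + r)) else 0)"
      by (simp add: coeff_one_plus_square_power)
  qed
  also have "coeff ([:1, 1::real:] ^ (2 * k)) (k + 2 * r) = real ((2 * k) choose (k + 2 * r))"
    by (cases "k + 2 * r \<le> 2 * k")
      (simp_all add: coeff_linear_poly_power coeff_eq_0 degree_linear_power binomial_eq_0)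
  finally show ?thesis
    by (simp add: sum_even_indices)
qed

text \<open>With t = x + 1/x, these are the coefficients of x^0 and x^2 in t^(2k). Their ratio
  k/(k+1) leaves the fraction 1/(k+1) of the central one.\<close>

lemma catalan_eq_choose_diff:
  "catalan k = real ((2 * k) choose k) - real ((2 * k) choose (k + 1))"
proof -
  have "Suc k * ((2 * k) choose Suc k) = k * ((2 * k) choose k)"
    using binomial_absorption[of k "2 * k"] binomial_absorb_comp[of "2 * k" k]
    by (simp only: mult_2 add_diff_cancel_left')
  then have "(real k + 1) * real ((2 * k) choose (k + 1)) = real k * real ((2 * k) choose k)"
    by (metis (no_types) Suc_eq_plus1 of_nat_1 of_nat_add of_nat_mult)
  then show ?thesis
    by (simp add: catalan_def field_simps)
qed

lemma central_binomial_Suc: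
  "(2 * Suc k) choose Suc k = 2 * (Suc (2 * k) choose k)"
  "Suc (2 * k) choose Suc k = Suc (2 * k) choose k"
  using binomial_symmetric[of k "Suc (2 * k)"] by (simp_all add: Suc_diff_le)

text \<open>Identifies the weight in the third left-hand side: it turns \<open>catalan k\<close>
  into the next Catalan number.\<close>

lemma catalan_Suc:
  "catalan (Suc k) = 2 * (2 * real k + 1) / (real k + 2) * catalan k"
proof -
  have "Suc k * (Suc (2 * k) choose k) = Suc (2 * k) * ((2 * k) choose k)"
    using binomial_absorb_comp[of "Suc (2 * k)" k] by (simp add: Suc_diff_le del: binomial_Suc_Suc)
  then have "(real k + 1) * real (Suc (2 * k) choose k) = (2 * real k + 1) * real ((2 * k) choose k)"
    by (metis (no_types, lifting) of_nat_Suc of_nat_mult of_nat_numeral add.commute)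
  then have choose_eq: "real (Suc (2 * k) choose k) = (2 * real k + 1) * real ((2 * k) choose k) / (real k + 1)"
    using nonzero_eq_divide_eq[of "real k + 1"] by (metis add.commute mult.commute of_nat_Suc of_nat_neq_0)
  show ?thesis
    unfolding catalan_def central_binomial_Suc(1) of_nat_mult choose_eq
    by (simp add: ac_simps)
qed

text \<open>Two Pascal steps on each binomial coefficient of \<open>catalan_eq_choose_diff\<close>
  at k+1; the multiples of \<open>(2 * k) choose Suc k\<close> cancel. The result is the x^0
  coefficient minus the x^2 coefficient of (t+2)^k.\<close>

lemma catalan_Suc_eq_choose_diff:
  "catalan (Suc k) = real ((2 * k) choose k) - real ((2 * k) choose (k + 2))"
proof -
  have "(2 * Suc k) choose Suc k = 2 * ((2 * k) choose k) + 2 * ((2 * k) choose Suc k)"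
    unfolding central_binomial_Suc(1) central_binomial_Suc(2)[symmetric] by simp
  moreover have "(2 * Suc k) choose (Suc k + 1)
      = ((2 * k) choose k) + 2 * ((2 * k) choose Suc k) + ((2 * k) choose (k + 2))"
    by simp
  ultimately show ?thesis
    unfolding catalan_eq_choose_diff by simp
qed

text \<open>Subtract the expansion for r = 1 from that for r = 0; each term then contains the
  difference that equals \<open>catalan j\<close>.\<close>

lemma touchard_identity:
  "catalan (Suc k) = (\<Sum>j\<le>k div 2. real (k choose (2 * j)) * 2 ^ (k - 2 * j) * catalan j)"
proof -
  have "catalan (Suc k) = real ((2 * k) choose (k + 2 * 0)) - real ((2 * k) choose (k + 2 * 1))"
    by (simp add: catalan_Suc_eq_choose_diff)
  then show ?thesis
    unfolding central_binomial_expansion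
    by (simp add: catalan_eq_choose_diff right_diff_distrib sum_subtractf)
qed

text \<open>Both sides are the average of (t+2)^k over [-2, 2]. The proof replaces the integral by
  absorption and the sum of the odd-index binomial coefficients.\<close>

lemma power_over_Suc_expansion:
  "2 ^ (2 * k) / (real k + 1)
     = (\<Sum>j\<le>k div 2. real (k choose (2 * j)) * 2 ^ (k - 2 * j) * (2 ^ (2 * j) / (2 * real j + 1)))"
proof -
  have "(\<Sum>j\<le>k div 2. real (k choose (2 * j)) * 2 ^ (k - 2 * j) * (2 ^ (2 * j) / (2 * real j + 1)))
      = (\<Sum>j\<le>k. if even j then 2 ^ k / (real k + 1) * real (Suc k choose Suc j) else 0)"
    unfolding sum_even_indices
  proof (rule sum.cong[OF refl])
    fix j assume "j \<in> {..k div 2}"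
    then have "2 * j \<le> k"
      by auto
    then have power: "(2::real) ^ k = 2 ^ (k - 2 * j) * 2 ^ (2 * j)"
      by (simp flip: power_add)
    \<comment> \<open>Absorption trades the varying denominator 2j+1 for the fixed k+1, at the price
      of raising both binomial arguments by one.\<close>
    have absorb: "(real k + 1) * real (k choose (2 * j)) = (2 * real j + 1) * real (Suc k choose Suc (2 * j))"
      using Suc_times_binomial[of "2 * j" k]
      by (metis (no_types, lifting) of_nat_Suc of_nat_mult of_nat_numeral add.commute)
    have "2 * real j + 1 \<noteq> 0" "real k + 1 \<noteq> 0"
      by linarith+
    then have quotient: "real (k choose (2 * j)) / (2 * real j + 1)
        = real (Suc k choose Suc (2 * j)) / (real k + 1)"
      using absorb by (metis frac_eq_eq mult.commute)
    have "real (k choose (2 * j)) * 2 ^ (k - 2 * j) * (2 ^ (2 * j) / (2 * real j + 1))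
        = real (k choose (2 * j)) / (2 * real j + 1) * (2 ^ (k - 2 * j) * 2 ^ (2 * j))"
      by simp
    also have "\<dots> = real (Suc k choose Suc (2 * j)) / (real k + 1) * 2 ^ k"
      by (simp only: quotient flip: power)
    also have "\<dots> = 2 ^ k / (real k + 1) * real (Suc k choose Suc (2 * j))"
      by (simp only: times_divide_eq_left times_divide_eq_right mult.commute)
    finally show "real (k choose (2 * j)) * 2 ^ (k - 2 * j) * (2 ^ (2 * j) / (2 * real j + 1))
        = 2 ^ k / (real k + 1) * real (Suc k choose Suc (2 * j))" .
  qed
  \<comment> \<open>Put i = j + 1: even j become odd i, and the added index i = 0 is even, so it
    contributes 0.\<close>
  also have "\<dots> = 2 ^ k / (real k + 1) *
      (\<Sum>i\<le>Suc k. if odd i then real (Suc k choose i) else 0)"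
    unfolding sum.atMost_Suc_shift
    by (simp add: sum_distrib_left if_distrib cong: if_cong del: binomial_Suc_Suc)
  \<comment> \<open>The odd-index coefficients make up half of 2^(k+1), as k+1 is positive.\<close>
  also have "\<dots> = 2 ^ k / (real k + 1) * 2 ^ k"
    using choose_odd_sum[of "Suc k", where 'a = real] by (simp del: binomial_Suc_Suc sum.atMost_Suc)
  also have "\<dots> = 2 ^ (2 * k) / (real k + 1)"
    by (simp add: mult_2 power_add)
  finally show ?thesis
    by (rule sym)
qed

theorem proposition6:
  fixes n :: nat
  shows "(\<Sum>k=0..n. (-1) ^ (n - k) * real (n choose k) * real ((2 * k) choose k))
           = (\<Sum>k=0..n div 2. real (n choose k) * real ((n - k) choose k))
       \<and> (\<Sum>k=0..n. (-1) ^ (n - k) * real (n choose k) * (2 ^ (2 * k) / (real k + 1)))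
           = (\<Sum>k=0..n div 2. real (n choose (2 * k)) * (2 ^ (2 * k) / (2 * real k + 1)))
       \<and> (\<Sum>k=0..n. (-1) ^ (n - k) * real (n choose k)
              * (2 * (2 * real k + 1) / (real k + 2)) * catalan k)
           = (\<Sum>k=0..n div 2. real (n choose (2 * k)) * catalan k)"
proof (intro conjI)
  \<comment> \<open>The transform produces the left form; trinomial revision converts it to the
    stated one, where 2k \<le> n holds throughout the range.\<close>
  have "real (n choose (2 * k)) * real ((2 * k) choose k) = real (n choose k) * real ((n - k) choose k)"
    if "k \<in> {0..n div 2}" for k
    using that choose_mult[of k "2 * k" n] by (simp flip: of_nat_mult)
  then show "(\<Sum>k=0..n. (-1) ^ (n - k) * real (n choose k) * real ((2 * k) choose k))
           = (\<Sum>k=0..n div 2. real (n choose k) * real ((n - k) choose k))"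
    using binomial_transform_even[OF central_binomial_expansion[where r = 0, simplified], of n]
    by simp
  show "(\<Sum>k=0..n. (-1) ^ (n - k) * real (n choose k) * (2 ^ (2 * k) / (real k + 1)))
           = (\<Sum>k=0..n div 2. real (n choose (2 * k)) * (2 ^ (2 * k) / (2 * real k + 1)))"
    by (rule binomial_transform_even[OF power_over_Suc_expansion])
  show "(\<Sum>k=0..n. (-1) ^ (n - k) * real (n choose k)
              * (2 * (2 * real k + 1) / (real k + 2)) * catalan k)
           = (\<Sum>k=0..n div 2. real (n choose (2 * k)) * catalan k)"
    using binomial_transform_even[OF touchard_identity, of n]
    by (simp add: catalan_Suc mult.assoc)
qed

end
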